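(* Let $H\bullet M^a=(H\bullet M^a_t)_{t\in\mathbb N}$ be the process defined in the context, and suppose that $\max_{c\in B}|c|\le b$ for some $b>0$. For any fixed $\mu\in(0,3)$ satisfying $\mu>\psi(\mu)=e^\mu-\mu-1$ and $\alpha>0$, define for $t\in\mathbb N$ $$H^2\bullet\hat P^a_t=\frac{\mu}{\mu-\psi(\mu)}\sum_{s=0}^tH_s^2\,1\{X_s=a\}+\frac{b^2\alpha}{\mu-\psi(\mu)} .$$ Then, for any fixed $\varepsilon>0$ and $v>w>0$, for every $t\in\mathbb N$, $$\mathbb P\Big(H\bullet M^a_t\ge\sqrt{2(1+\varepsilon)\alpha\,H^2\bullet\hat P^a_t}+\frac{\alpha b}3,\ w\le H^2\bullet\hat P^a_t\le v\Big)\le2\left\lceil\frac{\log(v/w+1)}{\log(1+\varepsilon)}\right\rceil e^{-\alpha}\,\mathbb P(\langle H\bullet M^a\rangle_t>0).$$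
   Context: $\mathbb N=\{0,1,2,\dots\}$. $(X_t)_{t\in\mathbb Z}$ is a stationary Markov chain of order $d\ge1$ on a finite alphabet $A$ with transition probabilities $p(a|x_{-d:-1})=\mathbb P(X_t=a|X_{t-d}=x_{-d},\dots,X_{t-1}=x_{-1})$; $X_{s:t}=(X_s,\dots,X_t)$. $\mathcal F_t=\sigma(X_{-d:t})$ for $t\in\mathbb N$. Fix $a\in A$ and let $M^a_t=1\{X_t=a\}-p(a|X_{(t-d):(t-1)})$, $t\in\mathbb N$. $H=(H_t)_{t\in\mathbb N}$ is a process with values in a finite set $B\subset\mathbb R$, with $H_0=0$ and $H_t$ being $\mathcal F_{t-1}$-measurable for all $t\ge1$. Define $$H\bullet M^a_t=\sum_{s=0}^tH_sM^a_s,\qquad\langle H\bullet M^a\rangle_t=\sum_{s=0}^tH_s^2\,p(a|X_{(s-d):(s-1)})\big(1-p(a|X_{(s-d):(s-1)})\big),$$ the latter being the predictable quadratic variation of the martingale $H\bullet M^a$. *)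

theory Defs
  imports "HOL-Probability.Probability"
begin

text \<open>The block \<open>X\<^bsub>s:t\<^esub> = (X\<^sub>s, ..., X\<^sub>t)\<close>, as a list (empty if \<open>t < s\<close>).\<close>

definition block :: "(int \<Rightarrow> 'w \<Rightarrow> 'a) \<Rightarrow> int \<Rightarrow> int \<Rightarrow> 'w \<Rightarrow> 'a list" where
  "block X s t \<omega> = map (\<lambda>i. X i \<omega>) [s..t]"

text \<open>
  In \<open>p a x\<close> the list \<open>x\<close> is the past of length \<open>d\<close>, oldest symbol first. As \<open>p\<close> is
  given by conditional probabilities, its values at pasts of probability zero are not constrained.
\<close>

locale stationary_markov_chain = prob_space M
  for M :: "'w measure"
    and A :: "'a set"
    and d :: nat
    and p :: "'a \<Rightarrow> 'a list \<Rightarrow> real"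
    and X :: "int \<Rightarrow> 'w \<Rightarrow> 'a" +
  assumes finite_alphabet: "finite A"
    and order_pos: "d \<ge> 1"
    and random_variable_X: "\<And>t. X t \<in> measurable M (count_space A)"
    and stationary: "\<And>k. distr M (\<Pi>\<^sub>M i\<in>UNIV. count_space A) (\<lambda>\<omega> i. X (i + k) \<omega>)
                        = distr M (\<Pi>\<^sub>M i\<in>UNIV. count_space A) (\<lambda>\<omega> i. X i \<omega>)"
    and transition: "\<And>s t a x. a \<in> A \<Longrightarrow> s \<le> t - int d \<Longrightarrow>
        \<P>(\<omega> in M. block X s (t - 1) \<omega> = map x [s..t - 1]) > 0 \<Longrightarrow>
        \<P>(\<omega> in M. X t \<omega> = a \<bar> block X s (t - 1) \<omega> = map x [s..t - 1])
          = p a (map x [t - int d..t - 1])"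

definition past_algebra :: "'w measure \<Rightarrow> nat \<Rightarrow> (int \<Rightarrow> 'w \<Rightarrow> 'a) \<Rightarrow> nat \<Rightarrow> 'w measure" where
  "past_algebra M d X t = vimage_algebra (space M) (block X (- int d) (int t)) (count_space UNIV)"

definition cond_p :: "nat \<Rightarrow> ('a \<Rightarrow> 'a list \<Rightarrow> real) \<Rightarrow> (int \<Rightarrow> 'w \<Rightarrow> 'a) \<Rightarrow> 'a \<Rightarrow> nat \<Rightarrow> 'w \<Rightarrow> real" where
  "cond_p d p X a t \<omega> = p a (block X (int t - int d) (int t - 1) \<omega>)"

definition mart_diff :: "nat \<Rightarrow> ('a \<Rightarrow> 'a list \<Rightarrow> real) \<Rightarrow> (int \<Rightarrow> 'w \<Rightarrow> 'a) \<Rightarrow> 'a \<Rightarrow> nat \<Rightarrow> 'w \<Rightarrow> real" where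
  "mart_diff d p X a t \<omega> = of_bool (X (int t) \<omega> = a) - cond_p d p X a t \<omega>"

definition mart :: "nat \<Rightarrow> ('a \<Rightarrow> 'a list \<Rightarrow> real) \<Rightarrow> (int \<Rightarrow> 'w \<Rightarrow> 'a) \<Rightarrow> 'a
    \<Rightarrow> (nat \<Rightarrow> 'w \<Rightarrow> real) \<Rightarrow> nat \<Rightarrow> 'w \<Rightarrow> real" where
  "mart d p X a H t \<omega> = (\<Sum>s\<le>t. H s \<omega> * mart_diff d p X a s \<omega>)"

definition pred_qvar :: "nat \<Rightarrow> ('a \<Rightarrow> 'a list \<Rightarrow> real) \<Rightarrow> (int \<Rightarrow> 'w \<Rightarrow> 'a) \<Rightarrow> 'a
    \<Rightarrow> (nat \<Rightarrow> 'w \<Rightarrow> real) \<Rightarrow> nat \<Rightarrow> 'w \<Rightarrow> real" where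
  "pred_qvar d p X a H t \<omega> =
     (\<Sum>s\<le>t. (H s \<omega>)\<^sup>2 * cond_p d p X a s \<omega> * (1 - cond_p d p X a s \<omega>))"

definition psi :: "real \<Rightarrow> real" where
  "psi \<mu> = exp \<mu> - \<mu> - 1"

definition P_hat :: "(int \<Rightarrow> 'w \<Rightarrow> 'a) \<Rightarrow> 'a \<Rightarrow> (nat \<Rightarrow> 'w \<Rightarrow> real)
    \<Rightarrow> real \<Rightarrow> real \<Rightarrow> real \<Rightarrow> nat \<Rightarrow> 'w \<Rightarrow> real" where
  "P_hat X a H b \<mu> \<alpha> t \<omega> =
     \<mu> / (\<mu> - psi \<mu>) * (\<Sum>s\<le>t. (H s \<omega>)\<^sup>2 * of_bool (X (int s) \<omega> = a))
     + b\<^sup>2 * \<alpha> / (\<mu> - psi \<mu>)"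

end

theory Submission
  imports Defs
begin

text \<open>
  For predictable \<open>K\<close> with \<open>\<bar>K\<bar> \<le> m\<close>, the exponential of
  \<open>\<Sum> K\<^sub>s M\<^sub>s - \<psi>(m)/m\<^sup>2 \<Sum> K\<^sub>s\<^sup>2 p\<^sub>s (1 - p\<^sub>s)\<close> has mean at most 1, and it
  equals 1 almost surely where the predictable variation \<open>V\<close> of \<open>H \<bullet> M\<close> vanishes. Hence the
  Chernoff bound gains the factor \<open>P(V > 0)\<close>. The choice \<open>K = -\<mu>H\<^sup>2/b\<^sup>2\<close> shows that
  \<open>V\<close> is dominated by its empirical version, up to probability \<open>exp(-\<alpha>) P(V > 0)\<close>. The choice
  \<open>K = \<lambda>H\<close> is Bernstein's inequality on an event where \<open>V\<close> is bounded; it is applied to each of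
  the geometric slices \<open>w(1+\<epsilon>)^k \<le> H\<^sup>2 \<bullet> P \<le> w(1+\<epsilon>)^(k+1)\<close>. With \<open>N\<close> slices the
  total is \<open>N + 1 \<le> 2N\<close> such terms.
\<close>

section \<open>Power series bounds for \<open>psi\<close> and the resulting exponents\<close>

lemma psi_series: "(\<lambda>n. x ^ (n + 2) / fact (n + 2)) sums psi x"
proof -
  have "(\<lambda>n. x ^ n / fact n) sums exp x"
    using exp_converges[of x] by (simp add: scaleR_conv_of_real field_simps)
  from sums_split_initial_segment[OF this, of 2]
  show ?thesis by (simp add: psi_def numeral_2_eq_2 algebra_simps)
qed

text \<open>The series of \<open>psi\<close> starts in degree two, so after splitting off
  \<open>x\<^sup>2\<close> the remaining powers are dominated by those of \<open>m\<close>, whatever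
  the sign of \<open>x\<close>. Both signs occur later: increments take either sign, and one of the
  integrands is negative.\<close>

lemma psi_le_scaled:
  fixes x m :: real
  assumes "\<bar>x\<bar> \<le> m" "m > 0"
  shows "psi x \<le> psi m / m\<^sup>2 * x\<^sup>2"
proof -
  have "x ^ (n + 2) / fact (n + 2) \<le> x\<^sup>2 / m\<^sup>2 * (m ^ (n + 2) / fact (n + 2))" for n
  proof -
    have "x ^ (n + 2) \<le> \<bar>x\<bar> ^ n * x\<^sup>2"
      by (metis abs_ge_self power_abs power_add abs_mult power2_abs)
    also have "\<dots> \<le> m ^ n * x\<^sup>2"
      using assms by (intro mult_right_mono power_mono) auto
    finally have "x ^ (n + 2) \<le> m ^ n * x\<^sup>2" .
    moreover have "x\<^sup>2 / m\<^sup>2 * (m ^ (n + 2) / fact (n + 2)) = m ^ n * x\<^sup>2 / fact (n + 2)"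
      using assms by (simp only: power_add) simp
    ultimately show ?thesis by (simp add: divide_right_mono)
  qed
  from sums_le[OF this psi_series sums_mult[OF psi_series]]
  show ?thesis by (simp add: field_simps)
qed

text \<open>Since (n + 2)! is at least 2 * 3^n, the series is dominated by a geometric one with
  ratio m / 3. This ratio is the origin of the 3 in the deviation term
  \<open>\<alpha> * b / 3\<close>.\<close>

lemma psi_le_bernstein:
  fixes m :: real
  assumes "0 \<le> m" "m < 3"
  shows "psi m \<le> m\<^sup>2 / (2 * (1 - m / 3))"
proof -
  have fact_ge: "2 * 3 ^ n \<le> (fact (n + 2) :: real)" for n
  proof (induction n)
    case (Suc n)
    have "2 * 3 ^ Suc n = 3 * (2 * 3 ^ n :: real)" by simp
    also have "\<dots> \<le> real (n + 3) * fact (n + 2)"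
      using Suc by (intro mult_mono) auto
    finally show ?case by (simp add: algebra_simps)
  qed (simp add: numeral_2_eq_2)
  have "m ^ (n + 2) / fact (n + 2) \<le> m\<^sup>2 / 2 * (m / 3) ^ n" for n
  proof -
    have "m ^ (n + 2) / fact (n + 2) \<le> m ^ (n + 2) / (2 * 3 ^ n)"
      using assms fact_ge[of n] by (intro divide_left_mono) auto
    also have "\<dots> = m\<^sup>2 / 2 * (m / 3) ^ n"
      by (simp add: power_add power_divide power2_eq_square)
    finally show ?thesis .
  qed
  from sums_le[OF this psi_series sums_mult[OF geometric_sums]]
  show ?thesis using assms by simp
qed

lemma psi_nonneg: "psi x \<ge> 0"
  unfolding psi_def using exp_ge_add_one_self[of x] by linarith

text \<open>The left side is the moment generating function at \<open>k\<close> of a centred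
  Bernoulli variable with parameter \<open>q\<close>. In the quadratic bound for the exponential the
  linear terms cancel, and the second moment is the variance \<open>q * (1 - q)\<close>.\<close>

lemma centered_bernoulli_mgf_le:
  fixes q k m :: real
  assumes q: "0 \<le> q" "q \<le> 1" and k: "\<bar>k\<bar> \<le> m" and m: "m > 0"
  shows "q * exp (k * (1 - q)) + (1 - q) * exp (- (k * q)) \<le> exp (psi m / m\<^sup>2 * k\<^sup>2 * q * (1 - q))"
proof -
  let ?c = "psi m / m\<^sup>2"
  have e: "exp x \<le> 1 + x + ?c * x\<^sup>2" if "\<bar>x\<bar> \<le> m" for x
    using psi_le_scaled[OF that m] by (simp add: psi_def)
  have "\<bar>k * (1 - q)\<bar> \<le> \<bar>k\<bar> * 1" "\<bar>- (k * q)\<bar> \<le> \<bar>k\<bar> * 1"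
    unfolding abs_mult abs_minus using q by (auto intro!: mult_left_le)
  then have b: "\<bar>k * (1 - q)\<bar> \<le> m" "\<bar>- (k * q)\<bar> \<le> m" using k by linarith+
  have "q * exp (k * (1 - q)) + (1 - q) * exp (- (k * q))
      \<le> q * (1 + k * (1 - q) + ?c * (k * (1 - q))\<^sup>2)
        + (1 - q) * (1 + - (k * q) + ?c * (- (k * q))\<^sup>2)"
    using q by (intro add_mono mult_left_mono e b) auto
  also have "\<dots> = 1 + ?c * k\<^sup>2 * q * (1 - q)" by (simp add: power2_eq_square) algebra
  also have "\<dots> \<le> exp (?c * k\<^sup>2 * q * (1 - q))" by (rule exp_ge_add_one_self)
  finally show ?thesis .
qed

text \<open>The witness is the maximiser of \<open>\<lambda>x - \<lambda>\<^sup>2u/(2(1 - \<lambda>b/3))\<close> at \<open>x = \<surd>(2\<alpha>u) + \<alpha>b/3\<close>.\<close>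

lemma bernstein_exponent:
  fixes u \<alpha> b :: real
  assumes "u > 0" "\<alpha> > 0" "b > 0"
  obtains l where "l > 0"
    "\<And>V x. V \<le> u \<Longrightarrow> x \<ge> sqrt (2 * \<alpha> * u) + \<alpha> * b / 3
        \<Longrightarrow> l * x - psi (l * b) / b\<^sup>2 * V \<ge> \<alpha>"
proof -
  define s where "s = sqrt (2 * \<alpha> / u)"
  define c where "c = b / 3"
  define l where "l = s / (1 + c * s)"
  have pos: "s > 0" "c > 0" "1 + c * s > 0" "l > 0"
    using assms by (auto simp: s_def c_def l_def add_pos_pos)
  have s2: "s\<^sup>2 * u = 2 * \<alpha>" using assms by (simp add: s_def)
  have "2 * \<alpha> * u = (s * u)\<^sup>2"
    unfolding s2[symmetric] by (simp add: power2_eq_square)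
  then have su: "sqrt (2 * \<alpha> * u) = s * u" using pos assms by simp
  \<comment> \<open>This identity keeps \<open>l * b\<close> below 3, as
    \<open>psi_le_bernstein\<close> requires, and turns the denominator of that bound into a
    reciprocal.\<close>
  have lc: "1 - l * c = 1 / (1 + c * s)" using pos by (simp add: l_def field_simps)
  have lb: "l * b = 3 * (l * c)" by (simp add: c_def)
  have "l * c < 1" using lc pos by (smt (verit) divide_pos_pos)
  then have lb3: "l * b < 3" using lb by linarith
  have "psi (l * b) / b\<^sup>2 * u \<le> (l * b)\<^sup>2 / (2 * (1 - l * b / 3)) / b\<^sup>2 * u"
    using pos assms lb3 by (intro mult_right_mono divide_right_mono psi_le_bernstein) auto
  also have "\<dots> = l\<^sup>2 * u / (2 * (1 - l * c))"
    using assms by (simp add: lb[symmetric] power_mult_distrib c_def)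
  also have "\<dots> = (s\<^sup>2 * u) / (2 * (1 + c * s))"
  proof -
    have "(s / D)\<^sup>2 * u / (2 * (1 / D)) = s\<^sup>2 * u / (2 * D)" if "D > 0" for D
      using that by (simp add: power2_eq_square field_simps)
    from this[OF pos(3)] show ?thesis unfolding lc unfolding l_def .
  qed
  also have "\<dots> = \<alpha> / (1 + c * s)" unfolding s2 by (rule mult_divide_mult_cancel_left) simp
  finally have psi_u: "psi (l * b) / b\<^sup>2 * u \<le> \<alpha> / (1 + c * s)" .
  show ?thesis
  proof (rule that[OF \<open>l > 0\<close>])
    fix V x assume V: "V \<le> u" and x: "x \<ge> sqrt (2 * \<alpha> * u) + \<alpha> * b / 3"
    have "psi (l * b) / b\<^sup>2 * V \<le> psi (l * b) / b\<^sup>2 * u"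
      using V by (intro mult_left_mono) (auto simp: psi_nonneg)
    moreover have "l * x \<ge> l * (s * u + \<alpha> * c)"
      using x pos su by (intro mult_left_mono) (auto simp: c_def)
    \<comment> \<open>By \<open>s2\<close> the linear gain splits into the target \<alpha> and
      exactly the bound \<open>psi_u\<close> on the quadratic cost.\<close>
    moreover have "l * (s * u + \<alpha> * c) = \<alpha> + \<alpha> / (1 + c * s)"
    proof -
      have "l * (s * u + \<alpha> * c) = (s\<^sup>2 * u + \<alpha> * c * s) / (1 + c * s)"
        by (simp add: l_def power2_eq_square algebra_simps)
      also have "\<dots> = \<alpha> + \<alpha> / (1 + c * s)"
        unfolding s2 using pos by (simp add: field_simps)
      finally show ?thesis .
    qed
    ultimately show "l * x - psi (l * b) / b\<^sup>2 * V \<ge> \<alpha>" using psi_u by linarith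
  qed
qed

text \<open>The least \<open>k\<close> whose upper endpoint reaches \<open>z\<close> works:
  minimality gives the lower endpoint if \<open>k\<close> is positive, and \<open>w \<le> z\<close>
  gives it if \<open>k = 0\<close>.\<close>

lemma geometric_slice:
  fixes w \<epsilon> z :: real
  assumes "w \<le> z" "z \<le> w * (1 + \<epsilon>) ^ n" "n \<ge> 1"
  obtains k where "k < n" "w * (1 + \<epsilon>) ^ k \<le> z" "z \<le> w * (1 + \<epsilon>) ^ Suc k"
proof -
  define k where "k = (LEAST k. z \<le> w * (1 + \<epsilon>) ^ Suc k)"
  have n: "z \<le> w * (1 + \<epsilon>) ^ Suc (n - 1)" using assms by simp
  have "z \<le> w * (1 + \<epsilon>) ^ Suc k" unfolding k_def by (rule LeastI, rule n)
  moreover have "k \<le> n - 1" unfolding k_def by (rule Least_le, rule n)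
  moreover have "w * (1 + \<epsilon>) ^ k \<le> z"
  proof (cases k)
    case (Suc j)
    then show ?thesis using not_less_Least[of j "\<lambda>k. z \<le> w * (1 + \<epsilon>) ^ Suc k"]
      unfolding k_def[symmetric] by (metis lessI linear)
  qed (use assms in auto)
  ultimately show ?thesis using that assms by (metis Suc_diff_1 less_Suc_eq_le not_one_le_zero neq0_conv)
qed

text \<open>A function of a finitely valued variable is a finite linear combination of indicators of
  level sets. Conditioning on the past thereby becomes finite summation over its values.\<close>

lemma (in prob_space) expectation_finite_range:
  fixes F :: "'b \<Rightarrow> real"
  assumes Y: "Y \<in> measurable M (count_space L)" and L: "finite L"
  shows "integrable M (\<lambda>\<omega>. F (Y \<omega>))"
    and "expectation (\<lambda>\<omega>. F (Y \<omega>)) = (\<Sum>y\<in>L. F y * prob {\<omega>\<in>space M. Y \<omega> = y})"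
proof -
  have [measurable]: "{\<omega>\<in>space M. Y \<omega> = y} \<in> events" if "y \<in> L" for y
  proof -
    have "{\<omega>\<in>space M. Y \<omega> = y} = Y -` {y} \<inter> space M" by auto
    with measurable_sets[OF Y, of "{y}"] that show ?thesis by simp
  qed
  let ?S = "\<lambda>\<omega>. \<Sum>y\<in>L. F y * indicator {\<omega>\<in>space M. Y \<omega> = y} \<omega>"
  have eq: "F (Y \<omega>) = ?S \<omega>" if "\<omega> \<in> space M" for \<omega>
  proof -
    have "?S \<omega> = (\<Sum>y\<in>L. if y = Y \<omega> then F y else 0)"
      using that by (intro sum.cong) (auto simp: indicator_def)
    then show ?thesis using measurable_space[OF Y that] L by simp
  qed
  have int: "integrable M ?S"
    by (intro Bochner_Integration.integrable_sum integrable_mult_right integrable_real_indicator)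
      (auto simp: emeasure_eq_measure)
  show "integrable M (\<lambda>\<omega>. F (Y \<omega>))"
    using int by (subst Bochner_Integration.integrable_cong[OF refl eq]) auto
  have "expectation (\<lambda>\<omega>. F (Y \<omega>)) = expectation ?S"
    by (rule Bochner_Integration.integral_cong[OF refl eq])
  also have "\<dots> = (\<Sum>y\<in>L. F y * prob {\<omega>\<in>space M. Y \<omega> = y})"
  proof (subst Bochner_Integration.integral_sum)
    fix y assume "y \<in> L"
    then show "integrable M (\<lambda>\<omega>. F y * indicator {\<omega>\<in>space M. Y \<omega> = y} \<omega>)"
      by (intro integrable_mult_right integrable_real_indicator) (auto simp: emeasure_eq_measure)
  next
    have "{\<omega>\<in>space M. Y \<omega> = y} \<inter> space M = {\<omega>\<in>space M. Y \<omega> = y}" for y by auto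
    then show "(\<Sum>y\<in>L. expectation (\<lambda>\<omega>. F y * indicator {\<omega>\<in>space M. Y \<omega> = y} \<omega>))
        = (\<Sum>y\<in>L. F y * prob {\<omega>\<in>space M. Y \<omega> = y})" by simp
  qed
  finally show "expectation (\<lambda>\<omega>. F (Y \<omega>)) = (\<Sum>y\<in>L. F y * prob {\<omega>\<in>space M. Y \<omega> = y})" .
qed

section \<open>Functions determined by the past\<close>

context stationary_markov_chain
begin

text \<open>The block known just before time \<open>n\<close>. The index counts the symbols from
  time 0 on; \<open>past 0\<close> is the initial block of \<open>d\<close> symbols.\<close>

definition past :: "nat \<Rightarrow> 'w \<Rightarrow> 'a list" where
  "past n = block X (- int d) (int n - 1)"

text \<open>A pointwise substitute for measurability with respect to the sigma-algebra generated by
  \<open>past n\<close>: only finitely many pasts occur, so constancy on their level sets is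
  enough.\<close>

definition past_determined :: "nat \<Rightarrow> ('w \<Rightarrow> real) \<Rightarrow> bool" where
  "past_determined n f \<longleftrightarrow>
     (\<forall>\<omega>\<in>space M. \<forall>\<omega>'\<in>space M. past n \<omega> = past n \<omega>' \<longrightarrow> f \<omega> = f \<omega>')"

lemma past_eq_iff:
  "past n \<omega> = past n \<omega>' \<longleftrightarrow> (\<forall>i. - int d \<le> i \<and> i < int n \<longrightarrow> X i \<omega> = X i \<omega>')"
  by (auto simp: past_def block_def)

text \<open>The factor \<open>g\<close> evaluates \<open>f\<close> at a chosen point with the
  prescribed past. On lists that are the past of no point its value is arbitrary.\<close>

lemma past_determinedE:
  assumes "past_determined n f"
  obtains g where "\<And>\<omega>. \<omega> \<in> space M \<Longrightarrow> f \<omega> = g (past n \<omega>)"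
proof
  fix \<omega> assume w: "\<omega> \<in> space M"
  let ?P = "\<lambda>\<omega>'. \<omega>' \<in> space M \<and> past n \<omega>' = past n \<omega>"
  have "?P (SOME \<omega>'. ?P \<omega>')" by (rule someI[of ?P \<omega>]) (use w in simp)
  then show "f \<omega> = (\<lambda>y. f (SOME \<omega>'. \<omega>' \<in> space M \<and> past n \<omega>' = y)) (past n \<omega>)"
    using assms w unfolding past_determined_def by (metis (lifting))
qed

lemma cond_p_past_determined: "past_determined n (cond_p d p X a n)"
  unfolding past_determined_def past_eq_iff cond_p_def block_def
  by (intro ballI impI arg_cong[where f = "p a"] map_cong) auto

lemma past_determined_mono:
  assumes "past_determined n f" "n \<le> m"
  shows "past_determined m f"
  unfolding past_determined_def
proof (intro ballI impI)
  fix \<omega> \<omega>' assume w: "\<omega> \<in> space M" "\<omega>' \<in> space M" "past m \<omega> = past m \<omega>'"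
  from w(3) have "past n \<omega> = past n \<omega>'" using assms(2) unfolding past_eq_iff by simp
  then show "f \<omega> = f \<omega>'" using assms(1) w unfolding past_determined_def by blast
qed

text \<open>Three slots accommodate an integrand, a transition probability and an increment
  together; simpler expressions are covered by repeating an argument.\<close>

lemma past_determined_compose:
  assumes "past_determined n f" "past_determined n g" "past_determined n h"
  shows "past_determined n (\<lambda>\<omega>. F (f \<omega>) (g \<omega>) (h \<omega>))"
  unfolding past_determined_def
proof (intro ballI impI)
  fix \<omega> \<omega>' assume "\<omega> \<in> space M" "\<omega>' \<in> space M" "past n \<omega> = past n \<omega>'"
  then have "f \<omega> = f \<omega>'" "g \<omega> = g \<omega>'" "h \<omega> = h \<omega>'"
    using assms unfolding past_determined_def by blast+
  then show "F (f \<omega>) (g \<omega>) (h \<omega>) = F (f \<omega>') (g \<omega>') (h \<omega>')" by simp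
qed

lemma mart_diff_past_determined: "past_determined (Suc n) (mart_diff d p X a n)"
  unfolding past_determined_def
proof (intro ballI impI)
  fix \<omega> \<omega>' assume w: "\<omega> \<in> space M" "\<omega>' \<in> space M" "past (Suc n) \<omega> = past (Suc n) \<omega>'"
  from w(3) have "X (int n) \<omega> = X (int n) \<omega>'" unfolding past_eq_iff by simp
  moreover have "past n \<omega> = past n \<omega>'" using w(3) unfolding past_eq_iff by simp
  then have "cond_p d p X a n \<omega> = cond_p d p X a n \<omega>'"
    using cond_p_past_determined[of n a] w unfolding past_determined_def by blast
  ultimately show "mart_diff d p X a n \<omega> = mart_diff d p X a n \<omega>'"
    by (simp only: mart_diff_def)
qed

definition pasts :: "nat \<Rightarrow> 'a list set" where
  "pasts n = {y. set y \<subseteq> A \<and> length y = d + n}"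

lemma finite_pasts: "finite (pasts n)"
  unfolding pasts_def using finite_alphabet by (rule finite_lists_length_eq)

lemma X_measurable_UNIV [measurable]: "X i \<in> measurable M (count_space UNIV)"
proof (rule measurable_compose[OF random_variable_X])
  show "(\<lambda>x. x) \<in> measurable (count_space A) (count_space UNIV)" by simp
qed

lemma past_level_set: "{\<omega>\<in>space M. past n \<omega> = y} \<in> events"
proof (cases "length y = d + n")
  case True
  have "past n \<omega> = y \<longleftrightarrow> (\<forall>j\<in>{..<d+n}. X (int j - int d) \<omega> = y ! j)" for \<omega>
    using True by (auto simp: past_def block_def list_eq_iff_nth_eq)
  then have "{\<omega>\<in>space M. past n \<omega> = y}
      = {\<omega>\<in>space M. \<forall>j\<in>{..<d+n}. X (int j - int d) \<omega> = y ! j}" by simp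
  also have "\<dots> \<in> events" by measurable
  finally show ?thesis .
next
  case False
  then have "{\<omega>\<in>space M. past n \<omega> = y} = {}" by (auto simp: past_def block_def)
  then show ?thesis by (metis sets.empty_sets)
qed

lemma past_measurable: "past n \<in> measurable M (count_space (pasts n))"
proof (subst measurable_count_space_eq2[OF finite_pasts], intro conjI ballI)
  show "past n \<in> space M \<rightarrow> pasts n"
    using measurable_space[OF random_variable_X]
    by (auto simp: past_def block_def pasts_def)
  fix y
  show "past n -` {y} \<inter> space M \<in> events"
    using past_level_set[of n y] by (simp add: vimage_def Int_def conj_commute)
qed

lemma past_determined_measurable:
  assumes "past_determined n f"
  shows "f \<in> borel_measurable M"
proof -
  obtain g where g: "\<And>\<omega>. \<omega> \<in> space M \<Longrightarrow> f \<omega> = g (past n \<omega>)"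
    using past_determinedE[OF assms] by blast
  have "(\<lambda>\<omega>. g (past n \<omega>)) \<in> borel_measurable M"
    by (rule measurable_compose[OF past_measurable]) simp
  then show ?thesis by (subst measurable_cong[OF g])
qed

lemma past_determined_integrable:
  assumes "past_determined n f"
  shows "integrable M f"
proof -
  obtain g where g: "\<And>\<omega>. \<omega> \<in> space M \<Longrightarrow> f \<omega> = g (past n \<omega>)"
    using past_determinedE[OF assms] by blast
  show ?thesis
    using expectation_finite_range(1)[OF past_measurable finite_pasts, where F = g]
    by (subst Bochner_Integration.integrable_cong[OF refl g]) auto
qed

text \<open>Every set of \<open>past_algebra\<close> is a preimage under the block, so with a point
  it contains all points having the same block. This is applied to a level set of \<open>f\<close>.
  The block up to time \<open>n\<close> is \<open>past (Suc n)\<close>, hence the shift of the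
  index.\<close>

lemma past_algebra_measurable_past_determined:
  assumes "f \<in> borel_measurable (past_algebra M d X n)"
  shows "past_determined (Suc n) f"
  unfolding past_determined_def
proof (intro ballI impI)
  fix \<omega> \<omega>' assume w: "\<omega> \<in> space M" "\<omega>' \<in> space M" "past (Suc n) \<omega> = past (Suc n) \<omega>'"
  have "f -` {f \<omega>} \<inter> space M \<in> sets (past_algebra M d X n)"
    using measurable_sets[OF assms, of "{f \<omega>}"] by (simp add: past_algebra_def)
  then obtain S where S: "f -` {f \<omega>} \<inter> space M = block X (- int d) (int n) -` S \<inter> space M"
    unfolding past_algebra_def by (auto simp: sets_vimage_algebra2)
  have "block X (- int d) (int n) \<omega> \<in> S" using S w(1) by blast
  then have "\<omega>' \<in> block X (- int d) (int n) -` S \<inter> space M" using w by (simp add: past_def)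
  then have "\<omega>' \<in> f -` {f \<omega>} \<inter> space M" by (simp only: S)
  then show "f \<omega> = f \<omega>'" by simp
qed

section \<open>Transition probabilities given the whole past\<close>

lemma transition_past:
  assumes a: "a \<in> A" and w: "\<omega> \<in> space M"
  shows "\<P>(\<omega>' in M. past n \<omega>' = past n \<omega> \<and> X (int n) \<omega>' = a)
       = cond_p d p X a n \<omega> * \<P>(\<omega>' in M. past n \<omega>' = past n \<omega>)"
proof (cases "\<P>(\<omega>' in M. past n \<omega>' = past n \<omega>) > 0")
  case True
  \<comment> \<open>Conditioning is on the whole block from time \<open>- int d\<close> on, while
    \<open>cond_p\<close> sees only its last \<open>d\<close> symbols: this is the Markov property
    of order \<open>d\<close>.\<close>
  have "\<P>(\<omega>' in M. X (int n) \<omega>' = a \<bar> past n \<omega>' = past n \<omega>) = cond_p d p X a n \<omega>"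
    using transition[OF a, of "- int d" "int n" "\<lambda>i. X i \<omega>"] True
    by (simp add: past_def cond_p_def block_def)
  then show ?thesis using True by (simp add: cond_prob_def field_simps conj_commute)
next
  case False
  \<comment> \<open>The value of \<open>p\<close> is unconstrained at a past of probability zero; in
    product form both sides vanish there.\<close>
  then have z: "\<P>(\<omega>' in M. past n \<omega>' = past n \<omega>) = 0"
    by (simp add: zero_less_measure_iff)
  have "\<P>(\<omega>' in M. past n \<omega>' = past n \<omega> \<and> X (int n) \<omega>' = a)
      \<le> \<P>(\<omega>' in M. past n \<omega>' = past n \<omega>)"
    by (rule finite_measure_mono) (auto intro: past_level_set)
  then show ?thesis using z by (simp add: measure_le_0_iff)
qed

lemma transition_past_compl:
  assumes a: "a \<in> A" and w: "\<omega> \<in> space M"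
  shows "\<P>(\<omega>' in M. past n \<omega>' = past n \<omega> \<and> X (int n) \<omega>' \<noteq> a)
       = (1 - cond_p d p X a n \<omega>) * \<P>(\<omega>' in M. past n \<omega>' = past n \<omega>)"
proof -
  let ?P = "{\<omega>'\<in>space M. past n \<omega>' = past n \<omega>}"
    and ?Q = "{\<omega>'\<in>space M. past n \<omega>' = past n \<omega> \<and> X (int n) \<omega>' = a}"
  have [measurable]: "?P \<in> events" by (rule past_level_set)
  have "?Q = ?P \<inter> {\<omega>'\<in>space M. X (int n) \<omega>' = a}" by auto
  then have [measurable]: "?Q \<in> events" by simp
  have "{\<omega>'\<in>space M. past n \<omega>' = past n \<omega> \<and> X (int n) \<omega>' \<noteq> a} = ?P - ?Q" by auto
  then have "\<P>(\<omega>' in M. past n \<omega>' = past n \<omega> \<and> X (int n) \<omega>' \<noteq> a) = prob ?P - prob ?Q"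
    by (simp add: finite_measure_Diff Collect_mono_iff)
  then show ?thesis using transition_past[OF a w] by (simp add: algebra_simps)
qed

text \<open>Almost every point lies in a level set of the past that has positive probability. There
  the product formulas for \<open>a\<close> and for its complement force the transition probability
  into [0, 1], and an outcome of conditional probability zero cannot be the one observed.\<close>

lemma AE_cond_p:
  assumes a: "a \<in> A"
  shows "AE \<omega> in M. 0 \<le> cond_p d p X a n \<omega> \<and> cond_p d p X a n \<omega> \<le> 1
      \<and> (cond_p d p X a n \<omega> = 0 \<longrightarrow> X (int n) \<omega> \<noteq> a)
      \<and> (cond_p d p X a n \<omega> = 1 \<longrightarrow> X (int n) \<omega> = a)"
proof -
  \<comment> \<open>The past is taken through time \<open>n\<close>, so that the symbol observed at
    time \<open>n\<close> is itself part of the event of positive probability.\<close>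
  have "AE \<omega> in M. \<forall>y\<in>pasts (Suc n). past (Suc n) \<omega> = y \<longrightarrow> \<P>(\<omega>' in M. past (Suc n) \<omega>' = y) > 0"
  proof (subst AE_finite_all[OF finite_pasts], intro ballI)
    fix y
    show "AE \<omega> in M. past (Suc n) \<omega> = y \<longrightarrow> \<P>(\<omega>' in M. past (Suc n) \<omega>' = y) > 0"
    proof (cases "\<P>(\<omega>' in M. past (Suc n) \<omega>' = y) > 0")
      case False
      then have "\<P>(\<omega>' in M. past (Suc n) \<omega>' = y) = 0" by (simp add: zero_less_measure_iff)
      then have "AE \<omega> in M. \<omega> \<notin> {\<omega>'\<in>space M. past (Suc n) \<omega>' = y}"
        by (simp only: prob_eq_0[OF past_level_set])
      then show ?thesis using AE_space by eventually_elim simp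
    qed simp
  qed
  moreover have "AE \<omega> in M. \<omega> \<in> space M" by simp
  ultimately show ?thesis
  proof eventually_elim
    case (elim \<omega>)
    let ?q = "cond_p d p X a n \<omega>"
    have "past (Suc n) \<omega> \<in> pasts (Suc n)"
      using measurable_space[OF past_measurable, of \<omega> "Suc n"] elim(2) by simp
    then have pos: "\<P>(\<omega>' in M. past (Suc n) \<omega>' = past (Suc n) \<omega>) > 0" using elim by blast
    have [measurable]: "{\<omega>'\<in>space M. past n \<omega>' = past n \<omega>} \<in> events" by (rule past_level_set)
    have ev: "{\<omega>'\<in>space M. past n \<omega>' = past n \<omega> \<and> R (X (int n) \<omega>')} \<in> events" for R :: "'a \<Rightarrow> bool"
    proof -
      have "{\<omega>'\<in>space M. past n \<omega>' = past n \<omega> \<and> R (X (int n) \<omega>')}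
        = {\<omega>'\<in>space M. past n \<omega>' = past n \<omega>} \<inter> {\<omega>'\<in>space M. R (X (int n) \<omega>')}" by auto
      moreover have "{\<omega>'\<in>space M. R (X (int n) \<omega>')} = X (int n) -` Collect R \<inter> space M" by auto
      ultimately show ?thesis
        using measurable_sets[OF X_measurable_UNIV, of "Collect R" "int n"] by simp
    qed
    have sub: "\<P>(\<omega>' in M. past (Suc n) \<omega>' = past (Suc n) \<omega>)
        \<le> \<P>(\<omega>' in M. past n \<omega>' = past n \<omega> \<and> R (X (int n) \<omega>'))" if "R (X (int n) \<omega>)" for R
      using that by (intro finite_measure_mono ev) (auto simp: past_eq_iff)
    have "\<P>(\<omega>' in M. past n \<omega>' = past n \<omega>) > 0"
      using sub[of "\<lambda>_. True"] pos by simp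
    moreover have "0 \<le> ?q * \<P>(\<omega>' in M. past n \<omega>' = past n \<omega>)"
      by (subst transition_past[OF a elim(2), symmetric]) simp
    moreover have "0 \<le> (1 - ?q) * \<P>(\<omega>' in M. past n \<omega>' = past n \<omega>)"
      by (subst transition_past_compl[OF a elim(2), symmetric]) simp
    moreover have "?q = 0 \<Longrightarrow> X (int n) \<omega> \<noteq> a"
      using sub[of "\<lambda>c. c = a"] transition_past[OF a elim(2), of n] pos by auto
    moreover have "?q = 1 \<Longrightarrow> X (int n) \<omega> = a"
      using sub[of "\<lambda>c. c \<noteq> a"] transition_past_compl[OF a elim(2), of n] pos by auto
    ultimately show ?case by (simp add: zero_le_mult_iff)
  qed
qed

section \<open>One-step averaging and the exponential supermartingale\<close>

lemma expectation_step_le: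
  assumes a: "a \<in> A"
    and f: "past_determined n f" "\<And>\<omega>. \<omega> \<in> space M \<Longrightarrow> f \<omega> \<ge> 0"
    and g: "past_determined n g1" "past_determined n g0"
    and le: "\<And>\<omega>. \<omega> \<in> space M \<Longrightarrow> 0 \<le> cond_p d p X a n \<omega> \<Longrightarrow> cond_p d p X a n \<omega> \<le> 1 \<Longrightarrow>
       cond_p d p X a n \<omega> * g1 \<omega> + (1 - cond_p d p X a n \<omega>) * g0 \<omega> \<le> 1"
  shows "expectation (\<lambda>\<omega>. f \<omega> * (if X (int n) \<omega> = a then g1 \<omega> else g0 \<omega>)) \<le> expectation f"
proof -
  obtain f' where f': "\<And>\<omega>. \<omega> \<in> space M \<Longrightarrow> f \<omega> = f' (past n \<omega>)"
    using past_determinedE[OF f(1)] by blast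
  obtain g1' where g1': "\<And>\<omega>. \<omega> \<in> space M \<Longrightarrow> g1 \<omega> = g1' (past n \<omega>)"
    using past_determinedE[OF g(1)] by blast
  obtain g0' where g0': "\<And>\<omega>. \<omega> \<in> space M \<Longrightarrow> g0 \<omega> = g0' (past n \<omega>)"
    using past_determinedE[OF g(2)] by blast
  let ?Y = "\<lambda>\<omega>. (past n \<omega>, X (int n) \<omega> = a)"
  let ?F = "\<lambda>(y, c). f' y * (if c then g1' y else g0' y)"
  let ?r = "\<lambda>y. \<P>(\<omega> in M. past n \<omega> = y)"
  have Y: "?Y \<in> measurable M (count_space (pasts n \<times> UNIV))"
  proof -
    have "?Y \<in> measurable M (count_space (pasts n) \<Otimes>\<^sub>M count_space UNIV)"
      using past_measurable by (intro measurable_Pair) auto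
    then show ?thesis
      by (simp add: pair_measure_countable finite_pasts countable_finite)
  qed
  have fin: "finite (pasts n \<times> (UNIV :: bool set))" using finite_pasts by simp
  have "expectation (\<lambda>\<omega>. f \<omega> * (if X (int n) \<omega> = a then g1 \<omega> else g0 \<omega>))
      = expectation (\<lambda>\<omega>. ?F (?Y \<omega>))"
    by (intro Bochner_Integration.integral_cong) (auto simp: f' g1' g0')
  also have "\<dots> = (\<Sum>y\<in>pasts n. \<Sum>c\<in>UNIV. ?F (y, c) * prob {\<omega>\<in>space M. ?Y \<omega> = (y, c)})"
    by (subst expectation_finite_range(2)[OF Y fin]) (auto simp: sum.cartesian_product intro!: sum.cong)
  also have "\<dots> \<le> (\<Sum>y\<in>pasts n. f' y * ?r y)"
  proof (rule sum_mono)
    fix y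
    show "(\<Sum>c\<in>UNIV. ?F (y, c) * prob {\<omega>\<in>space M. ?Y \<omega> = (y, c)}) \<le> f' y * ?r y"
    proof (cases "?r y > 0")
      \<comment> \<open>A past of positive probability is attained at some point, which supplies its
        transition probability \<open>?q\<close>. The two outcomes at time \<open>n\<close> then
        have weights \<open>?q\<close> and \<open>1 - ?q\<close>.\<close>
      case True
      then have "{\<omega>\<in>space M. past n \<omega> = y} \<noteq> {}" by (metis less_irrefl measure_empty)
      then obtain \<omega> where w: "\<omega> \<in> space M" "y = past n \<omega>" by auto
      let ?q = "cond_p d p X a n \<omega>"
      have "0 \<le> ?q * ?r y" "0 \<le> (1 - ?q) * ?r y"
        unfolding w(2)
        by (subst transition_past[OF a w(1), symmetric] transition_past_compl[OF a w(1), symmetric],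
            simp)+
      then have "0 \<le> ?q" "?q \<le> 1" using True by (auto simp: zero_le_mult_iff)
      \<comment> \<open>The bound \<open>le\<close> is available only for transition probabilities
        in [0, 1]; other values can occur only at pasts of probability zero.\<close>
      from le[OF w(1) this] have "?q * g1' y + (1 - ?q) * g0' y \<le> 1"
        using w g1' g0' by simp
      moreover have "0 \<le> f' y" using f(2)[OF w(1)] f'[OF w(1)] w(2) by simp
      ultimately have "(f' y * ?r y) * (?q * g1' y + (1 - ?q) * g0' y) \<le> (f' y * ?r y) * 1"
        by (intro mult_left_mono) auto
      moreover have "(\<Sum>c\<in>UNIV. ?F (y, c) * prob {\<omega>\<in>space M. ?Y \<omega> = (y, c)})
          = (f' y * ?r y) * (?q * g1' y + (1 - ?q) * g0' y)"
      proof -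
        have "prob {\<omega>'\<in>space M. ?Y \<omega>' = (y, True)} = ?q * ?r y"
          "prob {\<omega>'\<in>space M. ?Y \<omega>' = (y, False)} = (1 - ?q) * ?r y"
          using transition_past[OF a w(1), of n] transition_past_compl[OF a w(1), of n]
          by (simp_all add: w(2))
        note probs = this
        have "(\<Sum>c\<in>UNIV. G c) = G True + G False" for G :: "bool \<Rightarrow> real"
          by (simp add: UNIV_bool)
        then have "(\<Sum>c\<in>UNIV. ?F (y, c) * prob {\<omega>\<in>space M. ?Y \<omega> = (y, c)})
            = f' y * g1' y * (?q * ?r y) + f' y * g0' y * ((1 - ?q) * ?r y)"
          unfolding probs[symmetric] by simp
        also have "\<dots> = (f' y * ?r y) * (?q * g1' y + (1 - ?q) * g0' y)"
          unfolding distrib_left by (simp only: mult_ac)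
        finally show ?thesis .
      qed
      ultimately show ?thesis by simp
    next
      case False
      then have z: "?r y = 0" by (simp add: zero_less_measure_iff)
      have "prob {\<omega>\<in>space M. ?Y \<omega> = (y, c)} \<le> ?r y" for c
        by (rule finite_measure_mono) (auto intro: past_level_set)
      then have "prob {\<omega>\<in>space M. ?Y \<omega> = (y, c)} = 0" for c
        by (simp only: z measure_le_0_iff)
      then show ?thesis using z by simp
    qed
  qed
  also have "\<dots> = expectation (\<lambda>\<omega>. f' (past n \<omega>))"
    by (rule expectation_finite_range(2)[OF past_measurable finite_pasts, symmetric])
  also have "\<dots> = expectation f"
    by (intro Bochner_Integration.integral_cong) (auto simp: f')
  finally show ?thesis .
qed

text \<open>The logarithm of the exponential supermartingale for the integrand \<open>K\<close>,
  compensated by a multiple of the predictable variation. The sum stops before \<open>n\<close>, so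
  that for predictable \<open>K\<close> its value is determined by \<open>past n\<close>; time
  \<open>t\<close> corresponds to the index \<open>Suc t\<close>.\<close>

definition log_supermart :: "'a \<Rightarrow> (nat \<Rightarrow> 'w \<Rightarrow> real) \<Rightarrow> real \<Rightarrow> nat \<Rightarrow> 'w \<Rightarrow> real" where
  "log_supermart a K m n \<omega> =
     (\<Sum>s<n. K s \<omega> * mart_diff d p X a s \<omega>
        - psi m / m\<^sup>2 * (K s \<omega>)\<^sup>2 * cond_p d p X a s \<omega> * (1 - cond_p d p X a s \<omega>))"

lemma past_determined_sum:
  assumes "\<And>s. s \<in> S \<Longrightarrow> past_determined n (f s)"
  shows "past_determined n (\<lambda>\<omega>. \<Sum>s\<in>S. f s \<omega>)"
  unfolding past_determined_def
proof (intro ballI impI sum.cong refl)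
  fix \<omega> \<omega>' s assume "\<omega> \<in> space M" "\<omega>' \<in> space M" "past n \<omega> = past n \<omega>'" "s \<in> S"
  then show "f s \<omega> = f s \<omega>'" using assms unfolding past_determined_def by blast
qed

lemma log_supermart_past_determined:
  assumes "\<And>s. past_determined s (K s)"
  shows "past_determined n (log_supermart a K m n)"
proof -
  have "past_determined n (\<lambda>\<omega>. K s \<omega> * mart_diff d p X a s \<omega>
      - psi m / m\<^sup>2 * (K s \<omega>)\<^sup>2 * cond_p d p X a s \<omega> * (1 - cond_p d p X a s \<omega>))"
    if "s \<in> {..<n}" for s
  proof -
    from that have s: "s \<le> n" "Suc s \<le> n" by auto
    show ?thesis
      by (rule past_determined_compose[OF past_determined_mono[OF assms[of s] s(1)]
            past_determined_mono[OF cond_p_past_determined[of s a] s(1)]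
            past_determined_mono[OF mart_diff_past_determined[of s a] s(2)],
            where F = "\<lambda>k q x. k * x - psi m / m\<^sup>2 * k\<^sup>2 * q * (1 - q)"])
  qed
  from past_determined_sum[of "{..<n}", OF this]
  show ?thesis unfolding log_supermart_def[abs_def] by simp
qed

text \<open>Induction on \<open>n\<close>: given the past, the new factor has mean at most 1, which
  is \<open>centered_bernoulli_mgf_le\<close> with the transition probability for \<open>q\<close>
  and the value of \<open>K n\<close> for \<open>k\<close>.\<close>

lemma expectation_exp_log_supermart_le:
  assumes a: "a \<in> A" and m: "m > 0"
    and K: "\<And>s. past_determined s (K s)" "\<And>s \<omega>. \<omega> \<in> space M \<Longrightarrow> \<bar>K s \<omega>\<bar> \<le> m"
  shows "expectation (\<lambda>\<omega>. exp (log_supermart a K m n \<omega>)) \<le> 1"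
proof (induction n)
  case 0
  then show ?case by (simp add: log_supermart_def prob_space)
next
  case (Suc n)
  let ?q = "cond_p d p X a n"
  let ?g = "\<lambda>x \<omega>. exp (K n \<omega> * (x - ?q \<omega>) - psi m / m\<^sup>2 * (K n \<omega>)\<^sup>2 * ?q \<omega> * (1 - ?q \<omega>))"
  have det: "past_determined n (?g x)" for x
    by (rule past_determined_compose[OF K(1)[of n] K(1)[of n] cond_p_past_determined[of n a],
          where F = "\<lambda>k _ q. exp (k * (x - q) - psi m / m\<^sup>2 * k\<^sup>2 * q * (1 - q))"])
  have "expectation (\<lambda>\<omega>. exp (log_supermart a K m (Suc n) \<omega>))
      = expectation (\<lambda>\<omega>. exp (log_supermart a K m n \<omega>) * (if X (int n) \<omega> = a then ?g 1 \<omega> else ?g 0 \<omega>))"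
    by (intro Bochner_Integration.integral_cong)
      (auto simp: log_supermart_def mart_diff_def exp_add[symmetric])
  also have "\<dots> \<le> expectation (\<lambda>\<omega>. exp (log_supermart a K m n \<omega>))"
  proof (rule expectation_step_le[OF a _ _ det det])
    show "past_determined n (\<lambda>\<omega>. exp (log_supermart a K m n \<omega>))"
      using log_supermart_past_determined[of K n a m, OF K(1)]
      by (intro past_determined_compose[where F = "\<lambda>x _ _. exp x"])
    fix \<omega> assume w: "\<omega> \<in> space M" "0 \<le> ?q \<omega>" "?q \<omega> \<le> 1"
    let ?D = "exp (psi m / m\<^sup>2 * (K n \<omega>)\<^sup>2 * ?q \<omega> * (1 - ?q \<omega>))"
    have "?q \<omega> * ?g 1 \<omega> + (1 - ?q \<omega>) * ?g 0 \<omega>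
        = (?q \<omega> * exp (K n \<omega> * (1 - ?q \<omega>)) + (1 - ?q \<omega>) * exp (- (K n \<omega> * ?q \<omega>))) / ?D"
      by (simp add: exp_diff add_divide_distrib)
    also have "\<dots> \<le> ?D / ?D"
      by (intro divide_right_mono centered_bernoulli_mgf_le) (use w K(2) m in auto)
    finally show "?q \<omega> * ?g 1 \<omega> + (1 - ?q \<omega>) * ?g 0 \<omega> \<le> 1" by simp
  qed simp
  finally show ?case using Suc by simp
qed

text \<open>A vanishing sum of nonnegative terms vanishes termwise. So at each time the integrand is
  0, or the transition probability is 0 or 1; in the latter case the outcome is almost surely forced
  and the increment is 0.\<close>

lemma AE_pred_qvar_zero:
  assumes a: "a \<in> A"
  shows "AE \<omega> in M. pred_qvar d p X a H t \<omega> \<le> 0 \<longrightarrow>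
    (\<forall>s\<le>t. H s \<omega> = 0 \<or> mart_diff d p X a s \<omega> = 0 \<and> cond_p d p X a s \<omega> * (1 - cond_p d p X a s \<omega>) = 0)"
proof -
  have "AE \<omega> in M. \<forall>s. 0 \<le> cond_p d p X a s \<omega> \<and> cond_p d p X a s \<omega> \<le> 1
      \<and> (cond_p d p X a s \<omega> = 0 \<longrightarrow> X (int s) \<omega> \<noteq> a)
      \<and> (cond_p d p X a s \<omega> = 1 \<longrightarrow> X (int s) \<omega> = a)"
    by (intro AE_all_countable[THEN iffD2] allI AE_cond_p[OF a])
  then show ?thesis
  proof eventually_elim
    case (elim \<omega>)
    show ?case
    proof (intro impI allI)
      fix s assume V: "pred_qvar d p X a H t \<omega> \<le> 0" and s: "s \<le> t"
      have nn: "(H s \<omega>)\<^sup>2 * cond_p d p X a s \<omega> * (1 - cond_p d p X a s \<omega>) \<ge> 0" for s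
        using elim by simp
      then have "pred_qvar d p X a H t \<omega> \<ge> 0" unfolding pred_qvar_def by (simp add: sum_nonneg)
      then have "(\<Sum>s\<le>t. (H s \<omega>)\<^sup>2 * cond_p d p X a s \<omega> * (1 - cond_p d p X a s \<omega>)) = 0"
        using V unfolding pred_qvar_def by linarith
      then have "(H s \<omega>)\<^sup>2 * cond_p d p X a s \<omega> * (1 - cond_p d p X a s \<omega>) = 0"
        using s nn by (subst (asm) sum_nonneg_eq_0_iff) auto
      then have "H s \<omega> = 0 \<or> cond_p d p X a s \<omega> = 0 \<or> cond_p d p X a s \<omega> = 1" by auto
      then show "H s \<omega> = 0 \<or> mart_diff d p X a s \<omega> = 0 \<and> cond_p d p X a s \<omega> * (1 - cond_p d p X a s \<omega>) = 0"
        using elim by (auto simp: mart_diff_def)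
    qed
  qed
qed

section \<open>Chernoff bounds for the martingale and for its variation\<close>

lemma pred_qvar_past_determined:
  assumes "\<And>s. past_determined s (H s)"
  shows "past_determined (Suc t) (pred_qvar d p X a H t)"
proof -
  have "past_determined (Suc t) (\<lambda>\<omega>. (H s \<omega>)\<^sup>2 * cond_p d p X a s \<omega> * (1 - cond_p d p X a s \<omega>))"
    if "s \<in> {..t}" for s
  proof -
    from that have s: "s \<le> Suc t" by simp
    note q = past_determined_mono[OF cond_p_past_determined[of s a] s]
    show ?thesis
      by (rule past_determined_compose[OF past_determined_mono[OF assms[of s] s] q q,
            where F = "\<lambda>h q _. h\<^sup>2 * q * (1 - q)"])
  qed
  from past_determined_sum[of "{..t}", OF this]
  show ?thesis unfolding pred_qvar_def[abs_def] by simp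
qed

text \<open>Markov's inequality, improved by the mass where the variation V vanishes: there the
  exponential is 1 almost surely, which uses up P(V \<le> 0) of a total mean of at most 1 and leaves
  at most P(V > 0). Assumption \<open>HK\<close> transfers vanishing from \<open>H\<close> to
  \<open>K\<close>.\<close>

lemma chernoff_log_supermart:
  assumes a: "a \<in> A" and m: "m > 0"
    and K: "\<And>s. past_determined s (K s)" "\<And>s \<omega>. \<omega> \<in> space M \<Longrightarrow> \<bar>K s \<omega>\<bar> \<le> m"
    and H: "\<And>s. past_determined s (H s)"
    and HK: "\<And>s \<omega>. \<omega> \<in> space M \<Longrightarrow> H s \<omega> = 0 \<Longrightarrow> K s \<omega> = 0"
  shows "{\<omega>\<in>space M. log_supermart a K m (Suc t) \<omega> \<ge> \<alpha> \<and> pred_qvar d p X a H t \<omega> > 0} \<in> events"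
    and "\<P>(\<omega> in M. log_supermart a K m (Suc t) \<omega> \<ge> \<alpha> \<and> pred_qvar d p X a H t \<omega> > 0)
      \<le> exp (- \<alpha>) * \<P>(\<omega> in M. pred_qvar d p X a H t \<omega> > 0)"
proof -
  let ?S = "log_supermart a K m (Suc t)" and ?V = "pred_qvar d p X a H t"
  have [measurable]: "?S \<in> borel_measurable M" "?V \<in> borel_measurable M"
    using past_determined_measurable[OF log_supermart_past_determined[of K, OF K(1)]]
      past_determined_measurable[OF pred_qvar_past_determined[of H, OF H]] by auto
  let ?E = "{\<omega>\<in>space M. ?S \<omega> \<ge> \<alpha> \<and> ?V \<omega> > 0}"
    and ?G = "{\<omega>\<in>space M. ?V \<omega> > 0}" and ?N = "{\<omega>\<in>space M. ?V \<omega> \<le> 0}"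
  show ev: "?E \<in> events" by measurable
  have [measurable]: "?G \<in> events" "?N \<in> events" by measurable
  have int: "integrable M (\<lambda>\<omega>. exp (?S \<omega>))"
    using log_supermart_past_determined[of K "Suc t" a m, OF K(1)]
    by (intro past_determined_integrable[of "Suc t"] past_determined_compose[where F = "\<lambda>x _ _. exp x"])
  have "AE \<omega> in M. ?V \<omega> \<le> 0 \<longrightarrow> ?S \<omega> = 0"
    using AE_pred_qvar_zero[OF a, of H t] AE_space
  proof eventually_elim
    case (elim \<omega>)
    show ?case
    proof
      assume "?V \<omega> \<le> 0"
      then have z: "H s \<omega> = 0 \<or> mart_diff d p X a s \<omega> = 0 \<and> cond_p d p X a s \<omega> * (1 - cond_p d p X a s \<omega>) = 0"
        if "s < Suc t" for s
        using elim(1) that by auto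
      show "?S \<omega> = 0" unfolding log_supermart_def
      proof (rule sum.neutral, intro ballI)
        fix s assume "s \<in> {..<Suc t}"
        then show "K s \<omega> * mart_diff d p X a s \<omega>
          - psi m / m\<^sup>2 * (K s \<omega>)\<^sup>2 * cond_p d p X a s \<omega> * (1 - cond_p d p X a s \<omega>) = 0"
          using z[of s] HK[OF elim(2), of s] by auto
      qed
    qed
  qed
  \<comment> \<open>The two events are disjoint. On the first the exponential is at least
    \<open>exp \<alpha>\<close>, on the second it equals 1 almost surely.\<close>
  then have "AE \<omega> in M. exp \<alpha> * indicator ?E \<omega> + indicator ?N \<omega> \<le> exp (?S \<omega>)"
    using AE_space by eventually_elim (auto simp: indicator_def)
  then have "expectation (\<lambda>\<omega>. exp \<alpha> * indicator ?E \<omega> + indicator ?N \<omega>) \<le> expectation (\<lambda>\<omega>. exp (?S \<omega>))"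
    using int ev by (intro integral_mono_AE) (auto simp: emeasure_eq_measure)
  also have "\<dots> \<le> 1" by (rule expectation_exp_log_supermart_le[OF a m K])
  finally have "exp \<alpha> * prob ?E + prob ?N \<le> 1"
    using ev by (simp add: emeasure_eq_measure)
  moreover have "prob ?N = 1 - prob ?G"
    by (subst prob_compl[symmetric]) (auto intro!: arg_cong[where f = prob])
  ultimately have "exp \<alpha> * prob ?E \<le> prob ?G" by simp
  then show "prob ?E \<le> exp (- \<alpha>) * prob ?G"
    by (simp add: exp_minus field_simps)
qed

text \<open>The integrand is \<open>l * H\<close>, with \<open>l\<close> from
  \<open>bernstein_exponent\<close> fitted to the cap \<open>u\<close> on the variation. The
  conclusion supplies a measurable event covering the deviation up to a null set, so that several
  caps can be combined by a union bound.\<close>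

lemma bernstein_mart:
  assumes a: "a \<in> A" and pos: "b > 0" "u > 0" "\<alpha> > 0"
    and H: "\<And>s. past_determined s (H s)" "\<And>s \<omega>. \<omega> \<in> space M \<Longrightarrow> \<bar>H s \<omega>\<bar> \<le> b"
  obtains E where "E \<in> events" "prob E \<le> exp (- \<alpha>) * \<P>(\<omega> in M. pred_qvar d p X a H t \<omega> > 0)"
    "AE \<omega> in M. mart d p X a H t \<omega> \<ge> sqrt (2 * \<alpha> * u) + \<alpha> * b / 3 \<and> pred_qvar d p X a H t \<omega> \<le> u
       \<longrightarrow> \<omega> \<in> E"
proof -
  obtain l where l: "l > 0"
    "\<And>V x. V \<le> u \<Longrightarrow> x \<ge> sqrt (2 * \<alpha> * u) + \<alpha> * b / 3
        \<Longrightarrow> l * x - psi (l * b) / b\<^sup>2 * V \<ge> \<alpha>"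
    using bernstein_exponent[OF pos(2,3,1)] by blast
  let ?K = "\<lambda>s \<omega>. l * H s \<omega>" and ?V = "pred_qvar d p X a H t"
  let ?E = "{\<omega>\<in>space M. log_supermart a ?K (l * b) (Suc t) \<omega> \<ge> \<alpha> \<and> ?V \<omega> > 0}"
  have K: "past_determined s (?K s)" for s
    by (rule past_determined_compose[OF H(1) H(1) H(1), where F = "\<lambda>h _ _. l * h"])
  have Kb: "\<bar>?K s \<omega>\<bar> \<le> l * b" if "\<omega> \<in> space M" for s \<omega>
    using H(2)[OF that] l(1) by (simp add: abs_mult)
  have lb: "l * b > 0" using l pos by simp
  note ch = chernoff_log_supermart[of a "l * b" ?K H \<alpha> t, OF a lb K Kb H(1)]
  show ?thesis
  proof (rule that)
    show "?E \<in> events" "prob ?E \<le> exp (- \<alpha>) * \<P>(\<omega> in M. ?V \<omega> > 0)"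
      by (rule ch; simp)+
    show "AE \<omega> in M. mart d p X a H t \<omega> \<ge> sqrt (2 * \<alpha> * u) + \<alpha> * b / 3 \<and> ?V \<omega> \<le> u \<longrightarrow> \<omega> \<in> ?E"
      using AE_pred_qvar_zero[OF a, of H t] AE_space
    proof eventually_elim
      case (elim \<omega>)
      show ?case
      proof
        assume h: "mart d p X a H t \<omega> \<ge> sqrt (2 * \<alpha> * u) + \<alpha> * b / 3 \<and> ?V \<omega> \<le> u"
        have "log_supermart a ?K (l * b) (Suc t) \<omega>
            = l * mart d p X a H t \<omega> - psi (l * b) / b\<^sup>2 * ?V \<omega>"
          using l(1) unfolding log_supermart_def mart_def pred_qvar_def
          by (simp add: lessThan_Suc_atMost sum_subtractf sum_distrib_left power_mult_distrib mult_ac)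
        then have "log_supermart a ?K (l * b) (Suc t) \<omega> \<ge> \<alpha>" using l(2) h by simp
        moreover have "?V \<omega> > 0"
        \<comment> \<open>Without variation the martingale is 0 almost surely, which is below the
          strictly positive threshold.\<close>
        proof (rule ccontr)
          assume "\<not> ?V \<omega> > 0"
          then have "mart d p X a H t \<omega> = 0"
            unfolding mart_def using elim(1) by (intro sum.neutral) auto
          moreover have "sqrt (2 * \<alpha> * u) + \<alpha> * b / 3 > 0"
            using pos by (intro add_pos_pos) auto
          ultimately show False using h by simp
        qed
        ultimately show "\<omega> \<in> ?E" using elim(2) by simp
      qed
    qed
  qed
qed

text \<open>Let V be the variation and N the sum of H^2 over the occurrences of \<open>a\<close>.
  Clearing the denominator of \<open>P_hat\<close> turns the event into (\<mu> - psi \<mu>) V -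
  \<mu> N > b^2 \<alpha>. Divided by b^2, the left side is at most \<open>log_supermart\<close> for
  the integrand -\<mu> H^2 / b^2, which is bounded by \<mu>.\<close>

lemma pred_qvar_le_P_hat:
  assumes a: "a \<in> A" and pos: "b > 0" "\<mu> > 0" "\<mu> > psi \<mu>" "\<alpha> > 0"
    and H: "\<And>s. past_determined s (H s)" "\<And>s \<omega>. \<omega> \<in> space M \<Longrightarrow> \<bar>H s \<omega>\<bar> \<le> b"
  obtains E where "E \<in> events" "prob E \<le> exp (- \<alpha>) * \<P>(\<omega> in M. pred_qvar d p X a H t \<omega> > 0)"
    "AE \<omega> in M. pred_qvar d p X a H t \<omega> > P_hat X a H b \<mu> \<alpha> t \<omega> \<longrightarrow> \<omega> \<in> E"
proof -
  let ?K = "\<lambda>s \<omega>. - (\<mu> / b\<^sup>2) * (H s \<omega>)\<^sup>2" and ?V = "pred_qvar d p X a H t"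
  let ?S = "log_supermart a ?K \<mu> (Suc t)"
  let ?E = "{\<omega>\<in>space M. ?S \<omega> \<ge> \<alpha> \<and> ?V \<omega> > 0}"
  have K: "past_determined s (?K s)" for s
    by (rule past_determined_compose[OF H(1) H(1) H(1), where F = "\<lambda>h _ _. - (\<mu> / b\<^sup>2) * h\<^sup>2"])
  have H2: "(H s \<omega>)\<^sup>2 \<le> b\<^sup>2" if "\<omega> \<in> space M" for s \<omega>
    using H(2)[OF that, of s] pos by (metis abs_ge_zero power2_abs power_mono)
  have Kb: "\<bar>?K s \<omega>\<bar> \<le> \<mu>" if "\<omega> \<in> space M" for s \<omega>
    using H2[OF that, of s] pos by (simp add: abs_mult field_simps)
  note ch = chernoff_log_supermart[of a \<mu> ?K H \<alpha> t, OF a pos(2) K Kb H(1)]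
  show ?thesis
  proof (rule that)
    show "?E \<in> events" "prob ?E \<le> exp (- \<alpha>) * \<P>(\<omega> in M. ?V \<omega> > 0)"
      by (rule ch; simp)+
    have "AE \<omega> in M. 0 \<le> cond_p d p X a s \<omega> \<and> cond_p d p X a s \<omega> \<le> 1" for s
      using AE_cond_p[OF a, of s] by eventually_elim blast
    then have "AE \<omega> in M. \<forall>s. 0 \<le> cond_p d p X a s \<omega> \<and> cond_p d p X a s \<omega> \<le> 1"
      by (intro AE_all_countable[THEN iffD2] allI)
    then show "AE \<omega> in M. ?V \<omega> > P_hat X a H b \<mu> \<alpha> t \<omega> \<longrightarrow> \<omega> \<in> ?E"
      using AE_space
    proof eventually_elim
      case (elim \<omega>)
      let ?q = "\<lambda>s. cond_p d p X a s \<omega>" and ?I = "\<lambda>s. of_bool (X (int s) \<omega> = a) :: real"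
      let ?N = "\<Sum>s\<le>t. (H s \<omega>)\<^sup>2 * ?I s"
      show ?case
      proof
        assume V: "?V \<omega> > P_hat X a H b \<mu> \<alpha> t \<omega>"
        have "P_hat X a H b \<mu> \<alpha> t \<omega> = (\<mu> * ?N + b\<^sup>2 * \<alpha>) / (\<mu> - psi \<mu>)"
          by (simp add: P_hat_def add_divide_distrib)
        then have V': "\<mu> * ?N + b\<^sup>2 * \<alpha> < (\<mu> - psi \<mu>) * ?V \<omega>"
          using V pos by (simp add: pos_divide_less_eq mult.commute)
        \<comment> \<open>The additive term \<open>b\<^sup>2 * \<alpha>\<close> forces positive
          variation even if \<open>a\<close> never occurs.\<close>
        have "\<mu> * ?N + b\<^sup>2 * \<alpha> > 0"
          using pos by (intro add_nonneg_pos mult_nonneg_nonneg sum_nonneg) auto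
        with V' have "?V \<omega> > 0" using pos by (smt (verit) mult_nonneg_nonpos)
        moreover have "((\<mu> - psi \<mu>) * ?V \<omega> - \<mu> * ?N) / b\<^sup>2 \<le> ?S \<omega>"
        proof -
          have "((\<mu> - psi \<mu>) * ?V \<omega> - \<mu> * ?N) / b\<^sup>2
             = (\<Sum>s\<le>t. ((\<mu> - psi \<mu>) * ((H s \<omega>)\<^sup>2 * ?q s * (1 - ?q s)) - \<mu> * ((H s \<omega>)\<^sup>2 * ?I s)) / b\<^sup>2)"
            unfolding pred_qvar_def sum_distrib_left
            by (simp only: sum_subtractf[symmetric] sum_divide_distrib)
          also have "\<dots> \<le> (\<Sum>s\<le>t. ?K s \<omega> * mart_diff d p X a s \<omega>
              - psi \<mu> / \<mu>\<^sup>2 * (?K s \<omega>)\<^sup>2 * ?q s * (1 - ?q s))"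
          proof (rule sum_mono)
            fix s
            let ?h = "(H s \<omega>)\<^sup>2" and ?x = "?q s * (1 - ?q s)"
            have x: "0 \<le> ?x" "?x \<le> ?q s" using elim(1) by (auto simp: mult_left_le)
            have h: "0 \<le> ?h" "?h * ?h \<le> ?h * b\<^sup>2"
              by (simp, rule mult_left_mono[OF H2[OF elim(2)]], simp)
            \<comment> \<open>The quadratic cost involves H^4; bounding one factor H^2 by b^2 brings
              it to the scale of the variation divided by b^2.\<close>
            have "psi \<mu> / \<mu>\<^sup>2 * (?K s \<omega>)\<^sup>2 * ?q s * (1 - ?q s) = psi \<mu> * ?x * (?h * ?h) / (b\<^sup>2 * b\<^sup>2)"
              using pos by (simp add: field_simps power2_eq_square)
            also have "\<dots> \<le> psi \<mu> * ?x * (?h * b\<^sup>2) / (b\<^sup>2 * b\<^sup>2)"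
              by (intro divide_right_mono mult_left_mono[OF h(2)] mult_nonneg_nonneg[OF psi_nonneg x(1)]) simp
            also have "\<dots> = psi \<mu> * (?h * ?x) / b\<^sup>2"
            proof -
              have "psi \<mu> * ?x * (?h * b\<^sup>2) = psi \<mu> * (?h * ?x) * b\<^sup>2" by (simp only: mult_ac)
              moreover have "b\<^sup>2 \<noteq> 0" using pos by simp
              ultimately show ?thesis by (simp only: nonzero_mult_divide_mult_cancel_right not_False_eq_True)
            qed
            finally have 1: "psi \<mu> / \<mu>\<^sup>2 * (?K s \<omega>)\<^sup>2 * ?q s * (1 - ?q s) \<le> psi \<mu> * (?h * ?x) / b\<^sup>2" .
            \<comment> \<open>The increment contains the probability \<open>?q s\<close>; lowering
              it to the variance \<open>?x\<close> produces a summand of the variation.\<close>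
            have "\<mu> * (?h * ?x) \<le> \<mu> * (?h * ?q s)"
              using x h pos by (intro mult_left_mono) auto
            then have "(\<mu> * (?h * ?x) - \<mu> * (?h * ?I s)) / b\<^sup>2 \<le> (\<mu> * (?h * ?q s) - \<mu> * (?h * ?I s)) / b\<^sup>2"
              by (intro divide_right_mono) auto
            also have "\<dots> = ?K s \<omega> * mart_diff d p X a s \<omega>"
              by (simp add: mart_diff_def diff_divide_distrib algebra_simps)
            finally have 2: "(\<mu> * (?h * ?x) - \<mu> * (?h * ?I s)) / b\<^sup>2 \<le> ?K s \<omega> * mart_diff d p X a s \<omega>" .
            have "((\<mu> - psi \<mu>) * (?h * ?q s * (1 - ?q s)) - \<mu> * (?h * ?I s)) / b\<^sup>2
              = (\<mu> * (?h * ?x) - \<mu> * (?h * ?I s)) / b\<^sup>2 - psi \<mu> * (?h * ?x) / b\<^sup>2"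
              unfolding diff_divide_distrib[symmetric] by (simp only: algebra_simps)
            then show "((\<mu> - psi \<mu>) * (?h * ?q s * (1 - ?q s)) - \<mu> * (?h * ?I s)) / b\<^sup>2
              \<le> ?K s \<omega> * mart_diff d p X a s \<omega> - psi \<mu> / \<mu>\<^sup>2 * (?K s \<omega>)\<^sup>2 * ?q s * (1 - ?q s)"
              using 1 2 by linarith
          qed
          finally show ?thesis by (simp only: log_supermart_def lessThan_Suc_atMost)
        qed
        moreover have "\<alpha> \<le> ((\<mu> - psi \<mu>) * ?V \<omega> - \<mu> * ?N) / b\<^sup>2"
          using V' pos by (simp add: pos_le_divide_eq algebra_simps)
        ultimately show "\<omega> \<in> ?E" using elim(2) by simp
      qed
    qed
  qed
qed

end

section \<open>Union bound over geometric slices\<close>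

theorem theorem6:
  fixes M :: "'w measure"
    and A :: "'a set"
    and d :: nat
    and p :: "'a \<Rightarrow> 'a list \<Rightarrow> real"
    and X :: "int \<Rightarrow> 'w \<Rightarrow> 'a"
    and a :: 'a
    and B :: "real set"
    and H :: "nat \<Rightarrow> 'w \<Rightarrow> real"
    and b \<mu> \<alpha> \<epsilon> v w :: real
    and t :: nat
  assumes "stationary_markov_chain M A d p X"
    and "a \<in> A"
    and "finite B"
    and "\<And>s \<omega>. \<omega> \<in> space M \<Longrightarrow> H s \<omega> \<in> B"
    and "\<And>\<omega>. \<omega> \<in> space M \<Longrightarrow> H 0 \<omega> = 0"
    and "\<And>s. s \<ge> 1 \<Longrightarrow> H s \<in> borel_measurable (past_algebra M d X (s - 1))"
    and "b > 0"
    and "Max ((\<lambda>c. \<bar>c\<bar>) ` B) \<le> b"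
    and "0 < \<mu>" and "\<mu> < 3"
    and "\<mu> > psi \<mu>"
    and "\<alpha> > 0"
    and "\<epsilon> > 0"
    and "v > w" and "w > 0"
  shows "\<P>(\<omega> in M.
             mart d p X a H t \<omega> \<ge> sqrt (2 * (1 + \<epsilon>) * \<alpha> * P_hat X a H b \<mu> \<alpha> t \<omega>) + \<alpha> * b / 3
             \<and> w \<le> P_hat X a H b \<mu> \<alpha> t \<omega> \<and> P_hat X a H b \<mu> \<alpha> t \<omega> \<le> v)
         \<le> 2 * real_of_int \<lceil>ln (v / w + 1) / ln (1 + \<epsilon>)\<rceil> * exp (- \<alpha>)
             * \<P>(\<omega> in M. pred_qvar d p X a H t \<omega> > 0)"
proof -
  interpret stationary_markov_chain M A d p X by fact
  note a = \<open>a \<in> A\<close> and pos = \<open>b > 0\<close> \<open>\<mu> > 0\<close> \<open>\<mu> > psi \<mu>\<close> \<open>\<alpha> > 0\<close> \<open>\<epsilon> > 0\<close> \<open>w > 0\<close> \<open>v > w\<close>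
  let ?M = "mart d p X a H t" and ?V = "pred_qvar d p X a H t" and ?P = "P_hat X a H b \<mu> \<alpha> t"
  let ?r = "exp (- \<alpha>) * \<P>(\<omega> in M. ?V \<omega> > 0)"
  \<comment> \<open>At time 0 the process is constant; from time 1 on, measurability at time
    \<open>s - 1\<close> means being determined by \<open>past s\<close>.\<close>
  have det: "past_determined s (H s)" for s
  proof (cases s)
    case 0
    then show ?thesis using assms(5) by (simp add: past_determined_def)
  next
    case (Suc n)
    then show ?thesis using past_algebra_measurable_past_determined[of "H s" n] assms(6)[of s] by simp
  qed
  have Hb: "\<bar>H s \<omega>\<bar> \<le> b" if "\<omega> \<in> space M" for s \<omega>
  proof -
    have "\<bar>H s \<omega>\<bar> \<le> Max ((\<lambda>c. \<bar>c\<bar>) ` B)"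
      by (intro Max_ge finite_imageI imageI assms(3) assms(4)[OF that])
    then show ?thesis using assms(8) by linarith
  qed
  \<comment> \<open>Starting from \<open>w\<close>, \<open>n\<close> slices of ratio 1 + \<epsilon>
    reach beyond \<open>v\<close>. Positivity of \<open>L\<close> ensures that there is at least one
    slice.\<close>
  define L where "L = ln (v / w + 1) / ln (1 + \<epsilon>)"
  define n where "n = nat \<lceil>L\<rceil>"
  have "ln (v / w + 1) > 0" "ln (1 + \<epsilon>) > 0" using pos by (auto intro!: ln_gt_zero)
  then have "L > 0" unfolding L_def by (rule divide_pos_pos)
  then have n: "n \<ge> 1" "real_of_int \<lceil>L\<rceil> = real n" "L \<le> real n"
    unfolding n_def by linarith+
  have "ln (v / w + 1) = L * ln (1 + \<epsilon>)" using pos by (simp add: L_def)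
  also have "\<dots> \<le> real n * ln (1 + \<epsilon>)" using n pos by (intro mult_right_mono) auto
  also have "\<dots> = ln ((1 + \<epsilon>) ^ n)" using pos by (simp add: ln_realpow)
  finally have "v / w + 1 \<le> (1 + \<epsilon>) ^ n" using pos by (subst (asm) ln_le_cancel_iff) (auto simp: add_pos_pos)
  then have "v / w \<le> (1 + \<epsilon>) ^ n" by simp
  then have vn: "v \<le> w * (1 + \<epsilon>) ^ n" using pos by (simp add: pos_divide_le_eq mult.commute)
  \<comment> \<open>A single event serves all slices: almost surely outside it, an upper bound on
    \<open>?P\<close> is also a cap on the variation.\<close>
  obtain E0 where E0: "E0 \<in> events" "prob E0 \<le> ?r" "AE \<omega> in M. ?V \<omega> > ?P \<omega> \<longrightarrow> \<omega> \<in> E0"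
    using pred_qvar_le_P_hat[of a b \<mu> \<alpha> H t, OF a pos(1-4) det Hb] by blast
  let ?u = "\<lambda>k. w * (1 + \<epsilon>) ^ Suc k"
  have u: "?u k > 0" for k using pos by simp
  have "\<forall>k. \<exists>E. E \<in> events \<and> prob E \<le> ?r \<and>
      (AE \<omega> in M. ?M \<omega> \<ge> sqrt (2 * \<alpha> * ?u k) + \<alpha> * b / 3 \<and> ?V \<omega> \<le> ?u k \<longrightarrow> \<omega> \<in> E)"
  proof
    fix k
    show "\<exists>E. E \<in> events \<and> prob E \<le> ?r \<and>
      (AE \<omega> in M. ?M \<omega> \<ge> sqrt (2 * \<alpha> * ?u k) + \<alpha> * b / 3 \<and> ?V \<omega> \<le> ?u k \<longrightarrow> \<omega> \<in> E)"
      using bernstein_mart[of a b "?u k" \<alpha> H t, OF a pos(1) u pos(4) det Hb] by blast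
  qed
  from choice[OF this] obtain E where E: "\<And>k. E k \<in> events" "\<And>k. prob (E k) \<le> ?r"
    "\<And>k. AE \<omega> in M. ?M \<omega> \<ge> sqrt (2 * \<alpha> * ?u k) + \<alpha> * b / 3 \<and> ?V \<omega> \<le> ?u k \<longrightarrow> \<omega> \<in> E k"
    by blast
  let ?U = "E0 \<union> (\<Union>k<n. E k)"
  let ?T = "{\<omega>\<in>space M. ?M \<omega> \<ge> sqrt (2 * (1 + \<epsilon>) * \<alpha> * ?P \<omega>) + \<alpha> * b / 3 \<and> w \<le> ?P \<omega> \<and> ?P \<omega> \<le> v}"
  have "AE \<omega> in M. \<forall>k. ?M \<omega> \<ge> sqrt (2 * \<alpha> * ?u k) + \<alpha> * b / 3 \<and> ?V \<omega> \<le> ?u k \<longrightarrow> \<omega> \<in> E k"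
    by (intro AE_all_countable[THEN iffD2] allI E(3))
  with E0(3) have "AE \<omega> in M. \<omega> \<in> ?T \<longrightarrow> \<omega> \<in> ?U"
  proof eventually_elim
    case (elim \<omega>)
    show ?case
    proof
      assume T: "\<omega> \<in> ?T"
      show "\<omega> \<in> ?U"
      proof (cases "?V \<omega> > ?P \<omega>")
        case False
        have "w \<le> ?P \<omega>" "?P \<omega> \<le> w * (1 + \<epsilon>) ^ n" using T vn by auto
        then obtain k where k: "k < n" "w * (1 + \<epsilon>) ^ k \<le> ?P \<omega>" "?P \<omega> \<le> ?u k"
          using geometric_slice n(1) by blast
        \<comment> \<open>The upper endpoint of a slice is 1 + \<epsilon> times the lower one, so
          the factor 1 + \<epsilon> in the threshold pays for replacing \<open>?P \<omega>\<close>
          by the cap \<open>?u k\<close>.\<close>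
        have "2 * \<alpha> * ?u k = 2 * (1 + \<epsilon>) * \<alpha> * (w * (1 + \<epsilon>) ^ k)" by simp
        also have "\<dots> \<le> 2 * (1 + \<epsilon>) * \<alpha> * ?P \<omega>" using k pos by (intro mult_left_mono) auto
        finally have "sqrt (2 * \<alpha> * ?u k) \<le> sqrt (2 * (1 + \<epsilon>) * \<alpha> * ?P \<omega>)" by (rule real_sqrt_le_mono)
        moreover have "?M \<omega> \<ge> sqrt (2 * (1 + \<epsilon>) * \<alpha> * ?P \<omega>) + \<alpha> * b / 3" using T by blast
        ultimately have "?M \<omega> \<ge> sqrt (2 * \<alpha> * ?u k) + \<alpha> * b / 3" by linarith
        moreover have "?V \<omega> \<le> ?u k" using k False by linarith
        ultimately have "\<omega> \<in> E k" using elim(2) by blast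
        then show ?thesis using k by blast
      qed (use elim in blast)
    qed
  qed
  then have "prob ?T \<le> prob ?U"
    using E0 E by (intro finite_measure_mono_AE) auto
  also have "\<dots> \<le> prob E0 + prob (\<Union>k<n. E k)"
    using E0 E by (intro measure_Un_le) auto
  also have "\<dots> \<le> prob E0 + (\<Sum>k<n. prob (E k))"
    using E by (intro add_left_mono finite_measure_subadditive_finite) auto
  also have "\<dots> \<le> ?r + (\<Sum>k<n. ?r)"
    using E0 E by (intro add_mono sum_mono) auto
  also have "\<dots> = (1 + real n) * ?r" by (simp add: distrib_right)
  also have "\<dots> \<le> (2 * real n) * ?r"
    using n by (intro mult_right_mono) auto
  finally show ?thesis unfolding L_def[symmetric] n(2) by (simp add: mult.assoc)
qed

end
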